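(* Let $n\ge 1$ and let $A$ be an $n\times n$ complex matrix with decomposition $A=\sum_{k=0}^{n-1}R_kD_k$, where each $R_k$ is circulant and $D_k$ is the diagonal matrix with $D_k(q,q)=e^{i\frac{2\pi kq}{n}}$ for $0\le q\le n-1$. Then the circulant matrices $R_k$ are produced by the following recursion. Set $A_0=A$. For $k=0,1,\dots,n-2$, $R_k$ is the circulant matrix with first column $$R_k(j,0)=\frac1n\,\mathbf 1^T\left(A_k\circ C^j\right)\mathbf 1,\qquad j=0,1,\dots,n-1$$ (that is, the entries of $A_k$ are averaged over each cycle), and $A_{k+1}=(A_k-R_k)D_{-1}$. Finally, $R_{n-1}=A_{n-1}$.
   Context: Rows and columns of $n\times n$ matrices are indexed by $0,1,\dots,n-1$. A matrix $R$ is circulant if $R(p,q)$ depends only on $p-q \bmod n$. $C$ is the $n\times n$ cyclic permutation matrix with $C(p,q)=1$ if $p\equiv q+1 \pmod n$ and $0$ otherwise. $\circ$ is the Hadamard (entrywise) product, $\mathbf 1$ is the all-ones column vector of length $n$, and $D_{-1}$ is the diagonal matrix with $D_{-1}(q,q)=e^{-i\frac{2\pi q}{n}}$. The $j$-th cycle of a matrix is the set of its entries supported on $C^j$. *)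

theory Defs
  imports Complex_Main "Jordan_Normal_Form.Matrix"
begin

definition circulant :: "nat \<Rightarrow> 'a mat \<Rightarrow> bool" where
  "circulant n R \<longleftrightarrow> R \<in> carrier_mat n n \<and>
     (\<exists>f :: int \<Rightarrow> 'a. \<forall>p<n. \<forall>q<n. R $$ (p, q) = f ((int p - int q) mod int n))"

definition circulant_of_col :: "'a vec \<Rightarrow> 'a mat" where
  "circulant_of_col c = mat (dim_vec c) (dim_vec c)
     (\<lambda>(p, q). c $ nat ((int p - int q) mod int (dim_vec c)))"

lemma circulant_iff_circulant_of_col:
  assumes "n \<ge> 1" "R \<in> carrier_mat n n"
  shows "circulant n R \<longleftrightarrow> R = circulant_of_col (col R 0)"
proof
  assume "circulant n R"
  then obtain f where f: "\<And>p q. p < n \<Longrightarrow> q < n \<Longrightarrow> R $$ (p, q) = f ((int p - int q) mod int n)"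
    unfolding circulant_def by blast
  show "R = circulant_of_col (col R 0)"
  proof (rule eq_matI)
    fix p q assume "p < dim_row (circulant_of_col (col R 0))" "q < dim_col (circulant_of_col (col R 0))"
    hence pq: "p < n" "q < n" using assms by (auto simp: circulant_of_col_def)
    have lt: "nat ((int p - int q) mod int n) < n" using assms(1)
      by (simp add: nat_less_iff)
    show "R $$ (p, q) = circulant_of_col (col R 0) $$ (p, q)"
      using assms pq lt f[OF pq] f[OF lt, of 0] by (simp add: circulant_of_col_def)
  qed (use assms in \<open>auto simp: circulant_of_col_def\<close>)
next
  assume R: "R = circulant_of_col (col R 0)"
  have "R $$ (p, q) = col R 0 $ nat ((int p - int q) mod int n)" if "p < n" "q < n" for p q
    by (subst R, use that assms in \<open>simp add: circulant_of_col_def\<close>)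
  thus "circulant n R"
    unfolding circulant_def using assms(2)
    by (intro conjI exI[of _ "\<lambda>d. col R 0 $ nat d"]) auto
qed

definition cyc_perm_mat :: "nat \<Rightarrow> complex mat" where
  "cyc_perm_mat n = mat n n (\<lambda>(p, q). if p mod n = (q + 1) mod n then 1 else 0)"

definition hadamard_prod :: "complex mat \<Rightarrow> complex mat \<Rightarrow> complex mat" (infixl "\<circ>\<^sub>H" 70) where
  "A \<circ>\<^sub>H B = mat (dim_row A) (dim_col A) (\<lambda>ij. A $$ ij * B $$ ij)"

definition ones_vec :: "nat \<Rightarrow> complex vec" where
  "ones_vec n = vec n (\<lambda>_. 1)"

text \<open>The index ranges over the integers so that it covers \<open>k = -1\<close> as well.\<close>

definition phase_diag :: "nat \<Rightarrow> int \<Rightarrow> complex mat" where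
  "phase_diag n k =
     mat_diag n (\<lambda>q. exp (\<i> * complex_of_real (2 * pi * of_int k * real q / real n)))"

text \<open>Positions of the entries that make up the \<open>j\<close>-th cycle of an \<open>n \<times> n\<close> matrix.\<close>

definition cycle_pos :: "nat \<Rightarrow> nat \<Rightarrow> (nat \<times> nat) set" where
  "cycle_pos n j = {(p, q). p < n \<and> q < n \<and> (cyc_perm_mat n ^\<^sub>m j) $$ (p, q) \<noteq> 0}"

text \<open>The scalar product of vectors is bilinear, without conjugation, so \<open>ones_vec n \<bullet> (M *\<^sub>v ones_vec n)\<close>
  is the product of the all-ones row, \<open>M\<close>, and the all-ones column.\<close>

definition cycle_mean_col :: "nat \<Rightarrow> complex mat \<Rightarrow> complex vec" where
  "cycle_mean_col n M = vec n (\<lambda>j.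
     1 / of_nat n * (ones_vec n \<bullet> ((M \<circ>\<^sub>H (cyc_perm_mat n ^\<^sub>m j)) *\<^sub>v ones_vec n)))"

fun residual :: "nat \<Rightarrow> complex mat \<Rightarrow> nat \<Rightarrow> complex mat" where
  "residual n A 0 = A"
| "residual n A (Suc k) =
     (residual n A k - circulant_of_col (cycle_mean_col n (residual n A k))) * phase_diag n (-1)"

end

theory Submission
  imports Defs
begin

text \<open>
  The recursion works because averaging over a cycle is a discrete Fourier projection. Along the
  \<open>j\<close>-th cycle, whose positions are \<open>((q + j) mod n, q)\<close> for \<open>q < n\<close>, each circulant \<open>R\<^sub>l\<close> is constant,
  so the entries of \<open>R\<^sub>l D\<^sub>m\<close> there are that constant times \<open>\<omega>\<^sup>m\<^sup>q\<close> with \<open>\<omega> = exp (2 \<pi> \<i> / n)\<close>. The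
  average of \<open>\<omega>\<^sup>m\<^sup>q\<close> over \<open>q\<close> vanishes for \<open>0 < m < n\<close> and is \<open>1\<close> for \<open>m = 0\<close>
  (\<open>sum_cis_multiples_eq_0\<close>). Hence averaging \<open>\<Sum>l\<ge>k. R\<^sub>l D\<^bsub>l-k\<^esub>\<close> over the cycles returns exactly the
  first column of \<open>R\<^sub>k\<close> (\<open>cycle_mean_col_shifted_tail\<close>).

  Subtracting \<open>R\<^sub>k\<close> and multiplying by \<open>D\<^bsub>-1\<^esub>\<close> turns this sum into \<open>\<Sum>l\<ge>k+1. R\<^sub>l D\<^bsub>l-(k+1)\<^esub>\<close>, so by
  induction every residual has this form (\<open>residual_eq_shifted_tail\<close>). For \<open>k = n - 1\<close> only the
  single term \<open>R\<^bsub>n-1\<^esub>\<close> remains.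
\<close>

section \<open>Cycles of a square matrix\<close>

lemma cyc_perm_mat_power:
  "cyc_perm_mat n ^\<^sub>m j = mat n n (\<lambda>(p, q). if p = (q + j) mod n then 1 else 0)"
proof (induction j)
  case 0
  show ?case by (rule eq_matI) (auto simp: cyc_perm_mat_def)
next
  case (Suc j)
  have "(\<Sum>r<n. (if p = (r + j) mod n then 1 else 0) * (if r mod n = (q + 1) mod n then 1 else 0))
      = (if p = (q + Suc j) mod n then 1 else (0::complex))" if "q < n" for p q
  proof -
    have "(\<Sum>r<n. (if p = (r + j) mod n then 1 else 0) * (if r mod n = (q + 1) mod n then 1 else 0))
        = (\<Sum>r<n. if r = (q + 1) mod n then (if p = (r + j) mod n then 1 else 0) else (0::complex))"
      by (intro sum.cong) auto
    also have "\<dots> = (if p = ((q + 1) mod n + j) mod n then 1 else 0)"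
      using that by (subst sum.delta) auto
    also have "((q + 1) mod n + j) mod n = (q + Suc j) mod n"
      by (simp add: mod_simps)
    finally show ?thesis .
  qed
  thus ?case
    unfolding pow_mat.simps Suc.IH
    by (intro eq_matI) (auto simp: cyc_perm_mat_def scalar_prod_def lessThan_atLeast0)
qed

lemma cycle_pos_eq_image: "cycle_pos n j = (\<lambda>q. ((q + j) mod n, q)) ` {..<n}"
  by (auto simp: cycle_pos_def cyc_perm_mat_power split: if_splits)

lemma sum_cycle_pos: "(\<Sum>pq\<in>cycle_pos n j. g pq) = (\<Sum>q<n. g ((q + j) mod n, q))"
  unfolding cycle_pos_eq_image by (subst sum.reindex) (auto simp: inj_on_def)

lemma card_cycle_pos: "card (cycle_pos n j) = n"
  unfolding cycle_pos_eq_image by (subst card_image) (auto simp: inj_on_def)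

lemma ones_hadamard_cyc_perm_mat_power:
  assumes M: "M \<in> carrier_mat n n"
  shows "ones_vec n \<bullet> ((M \<circ>\<^sub>H (cyc_perm_mat n ^\<^sub>m j)) *\<^sub>v ones_vec n) =
         (\<Sum>pq\<in>cycle_pos n j. M $$ pq)"
proof -
  have "ones_vec n \<bullet> ((M \<circ>\<^sub>H (cyc_perm_mat n ^\<^sub>m j)) *\<^sub>v ones_vec n)
      = (\<Sum>p<n. \<Sum>q<n. if p = (q + j) mod n then M $$ (p, q) else 0)"
    using M by (auto simp: scalar_prod_def ones_vec_def hadamard_prod_def cyc_perm_mat_power
        lessThan_atLeast0 intro!: sum.cong)
  also have "\<dots> = (\<Sum>q<n. \<Sum>p<n. if p = (q + j) mod n then M $$ (p, q) else 0)"
    by (rule sum.swap)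
  also have "\<dots> = (\<Sum>q<n. M $$ ((q + j) mod n, q))"
    by (intro sum.cong) (auto simp: sum.delta)
  finally show ?thesis by (simp add: sum_cycle_pos)
qed

lemma cycle_mean_col_eq_average:
  assumes "M \<in> carrier_mat n n"
  shows "cycle_mean_col n M =
    vec n (\<lambda>j. (\<Sum>pq\<in>cycle_pos n j. M $$ pq) / of_nat (card (cycle_pos n j)))"
  using assms
  by (simp add: cycle_mean_col_def ones_hadamard_cyc_perm_mat_power card_cycle_pos)

lemma circulant_const_on_cycle:
  assumes "circulant n R" and "q < n" and "j < n"
  shows "R $$ ((q + j) mod n, q) = R $$ (j, 0)"
proof -
  obtain f where f: "\<And>p q. p < n \<Longrightarrow> q < n \<Longrightarrow> R $$ (p, q) = f ((int p - int q) mod int n)"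
    using assms(1) unfolding circulant_def by blast
  have "(int ((q + j) mod n) - int q) mod int n = (int j - int 0) mod int n"
    by (simp add: zmod_int mod_simps)
  thus ?thesis using assms f by simp
qed

section \<open>Modulation by phases\<close>

lemma mult_phase_diag:
  assumes "M \<in> carrier_mat n n"
  shows "M * phase_diag n k =
    mat n n (\<lambda>(p, q). M $$ (p, q) * cis (2 * pi * of_int k * real q / real n))"
  unfolding phase_diag_def mat_diag_mult_right[OF assms] cis_conv_exp ..

text \<open>The \<open>m\<close>-th power of a primitive \<open>n\<close>-th root of unity is an \<open>n\<close>-th root of unity other than \<open>1\<close>,
  so its powers form a geometric progression that sums to zero over one period.\<close>

lemma sum_cis_multiples_eq_0:
  assumes "0 < m" and "m < n"
  shows "(\<Sum>q<n. cis (2 * pi * real m * real q / real n)) = 0"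
proof -
  define z where "z = cis (2 * pi * real m / real n)"
  have "inj_on (\<lambda>k. cis (2 * pi * real k / real n)) {..<n}"
    using bij_betw_roots_unity[of n] assms by (auto simp: bij_betw_def)
  from inj_onD[OF this, of m 0] have "z \<noteq> 1"
    using assms by (auto simp: z_def)
  moreover have "z ^ n = 1"
    using assms by (simp add: z_def DeMoivre cis_multiple_2pi)
  ultimately have "(\<Sum>q<n. z ^ q) = 0"
    by (simp add: geometric_sum)
  thus ?thesis by (simp add: z_def DeMoivre mult_ac)
qed

section \<open>The residuals as shifted tails of the decomposition\<close>

text \<open>This is \<open>\<Sum>l\<in>{k..<n}. R l * phase_diag n (l - k)\<close>, written entrywise.\<close>

definition shifted_tail :: "nat \<Rightarrow> (nat \<Rightarrow> complex mat) \<Rightarrow> nat \<Rightarrow> complex mat" where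
  "shifted_tail n R k = mat n n (\<lambda>(p, q).
     \<Sum>l=k..<n. R l $$ (p, q) * cis (2 * pi * (real l - real k) * real q / real n))"

lemma shifted_tail_carrier [simp]: "shifted_tail n R k \<in> carrier_mat n n"
  by (simp add: shifted_tail_def)

lemma finsum_module_mat:
  fixes F :: "'i \<Rightarrow> 'a :: comm_ring_1 mat"
  assumes "finite I" and "\<And>i. i \<in> I \<Longrightarrow> F i \<in> carrier_mat nr nc"
  shows "(\<Oplus>\<^bsub>module_mat TYPE('a) nr nc\<^esub>i\<in>I. F i) =
    mat nr nc (\<lambda>pq. \<Sum>i\<in>I. F i $$ pq)"
proof -
  interpret abelian_group "module_mat TYPE('a) nr nc"
    by (rule abelian_group_mat)
  show ?thesis using assms
  proof (induction I rule: finite_induct)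
    case empty
    show ?case by (rule eq_matI) (auto simp: module_mat_simps)
  next
    case (insert i I)
    hence "(\<Oplus>\<^bsub>module_mat TYPE('a) nr nc\<^esub>i\<in>insert i I. F i) =
        F i + (\<Oplus>\<^bsub>module_mat TYPE('a) nr nc\<^esub>i\<in>I. F i)"
      by (subst finsum_insert) (auto simp: module_mat_simps)
    also have "\<dots> = F i + mat nr nc (\<lambda>pq. \<Sum>i\<in>I. F i $$ pq)"
      using insert by simp
    also have "\<dots> = mat nr nc (\<lambda>pq. \<Sum>i\<in>insert i I. F i $$ pq)"
      using insert by (intro eq_matI) auto
    finally show ?case .
  qed
qed

lemma finsum_phase_diag_eq_shifted_tail:
  assumes "\<And>k. k < n \<Longrightarrow> R k \<in> carrier_mat n n"
  shows "(\<Oplus>\<^bsub>module_mat TYPE(complex) n n\<^esub>k\<in>{..<n}. R k * phase_diag n (int k)) =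
    shifted_tail n R 0"
proof -
  have "(\<Oplus>\<^bsub>module_mat TYPE(complex) n n\<^esub>k\<in>{..<n}. R k * phase_diag n (int k)) =
      mat n n (\<lambda>pq. \<Sum>k<n. (R k * phase_diag n (int k)) $$ pq)"
    using assms by (intro finsum_module_mat) (auto simp: mult_phase_diag)
  also have "\<dots> = shifted_tail n R 0"
    using assms
    by (intro eq_matI) (auto simp: shifted_tail_def mult_phase_diag lessThan_atLeast0 intro!: sum.cong)
  finally show ?thesis .
qed

text \<open>Averaging over a cycle annihilates every summand whose phase rotates, which leaves the
  leading circulant only.\<close>

lemma cycle_mean_col_shifted_tail:
  assumes circ: "\<And>l. l < n \<Longrightarrow> circulant n (R l)" and "k < n"
  shows "cycle_mean_col n (shifted_tail n R k) = col (R k) 0"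
proof (rule eq_vecI)
  have Rk: "R k \<in> carrier_mat n n"
    using circ[OF \<open>k < n\<close>] by (simp add: circulant_def)
  fix j assume "j < dim_vec (col (R k) 0)"
  hence j: "j < n" using Rk by simp
  have phase_sum: "(\<Sum>q<n. cis (2 * pi * (real l - real k) * real q / real n)) =
      (if l = k then of_nat n else 0)" if "l \<in> {k..<n}" for l
    using that sum_cis_multiples_eq_0[of "l - k" n] by (auto simp: of_nat_diff)
  have "(\<Sum>pq\<in>cycle_pos n j. shifted_tail n R k $$ pq) =
      (\<Sum>q<n. \<Sum>l=k..<n. R l $$ (j, 0) * cis (2 * pi * (real l - real k) * real q / real n))"
    using circ j
    by (auto simp: sum_cycle_pos shifted_tail_def circulant_const_on_cycle intro!: sum.cong)
  also have "\<dots> = (\<Sum>l=k..<n. R l $$ (j, 0) *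
      (\<Sum>q<n. cis (2 * pi * (real l - real k) * real q / real n)))"
    by (subst sum.swap) (simp add: sum_distrib_left)
  also have "\<dots> = (\<Sum>l=k..<n. if l = k then R l $$ (j, 0) * of_nat n else 0)"
    by (intro sum.cong) (auto simp: phase_sum)
  also have "\<dots> = R k $$ (j, 0) * of_nat n"
    using \<open>k < n\<close> by simp
  finally show "cycle_mean_col n (shifted_tail n R k) $ j = col (R k) 0 $ j"
    using j Rk by (simp add: cycle_mean_col_eq_average card_cycle_pos)
qed (use circ[OF \<open>k < n\<close>] in \<open>auto simp: circulant_def cycle_mean_col_def\<close>)

lemma shifted_tail_step:
  assumes "R k \<in> carrier_mat n n" and "k < n"
  shows "(shifted_tail n R k - R k) * phase_diag n (-1) = shifted_tail n R (Suc k)"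
proof -
  have "((\<Sum>l=k..<n. R l $$ (p, q) * cis (2 * pi * (real l - real k) * real q / real n)) - R k $$ (p, q)) *
      cis (- (2 * pi * real q / real n)) =
      (\<Sum>l=Suc k..<n. R l $$ (p, q) * cis (2 * pi * (real l - real (Suc k)) * real q / real n))" for p q
  proof -
    have "((\<Sum>l=k..<n. R l $$ (p, q) * cis (2 * pi * (real l - real k) * real q / real n)) - R k $$ (p, q)) *
        cis (- (2 * pi * real q / real n)) =
        (\<Sum>l=Suc k..<n. R l $$ (p, q) * (cis (2 * pi * (real l - real k) * real q / real n) *
          cis (- (2 * pi * real q / real n))))"
      using \<open>k < n\<close> by (simp add: sum.atLeast_Suc_lessThan sum_distrib_right mult.assoc)
    also have "\<dots> = (\<Sum>l=Suc k..<n. R l $$ (p, q) *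
        cis (2 * pi * (real l - real (Suc k)) * real q / real n))"
      by (intro sum.cong refl arg_cong2[where f = "(*)"])
        (simp add: cis_mult diff_divide_distrib[symmetric] algebra_simps)
    finally show ?thesis .
  qed
  moreover have "shifted_tail n R k - R k \<in> carrier_mat n n"
    using assms by (intro minus_carrier_mat) auto
  ultimately show ?thesis
    using assms by (intro eq_matI) (auto simp: mult_phase_diag shifted_tail_def)
qed

lemma residual_eq_shifted_tail:
  assumes circ: "\<And>l. l < n \<Longrightarrow> circulant n (R l)"
  shows "k < n \<Longrightarrow> residual n (shifted_tail n R 0) k = shifted_tail n R k"
proof (induction k)
  case (Suc k)
  hence k: "k < n" by simp
  hence Rk: "R k \<in> carrier_mat n n"
    using circ by (auto simp: circulant_def)
  have "circulant_of_col (col (R k) 0) = R k"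
    using circulant_iff_circulant_of_col[of n "R k"] circ[OF k] Rk k by simp
  thus ?case
    using Suc.IH k Rk by (simp add: cycle_mean_col_shifted_tail circ shifted_tail_step)
qed simp

theorem mainTheorem3:
  fixes n :: nat and A :: "complex mat" and R :: "nat \<Rightarrow> complex mat"
  assumes "n \<ge> 1"
    and "A \<in> carrier_mat n n"
    and "\<And>k. k < n \<Longrightarrow> circulant n (R k)"
    and "A = (\<Oplus>\<^bsub>module_mat TYPE(complex) n n\<^esub>k\<in>{..<n}. R k * phase_diag n (int k))"
  shows "(\<forall>k. k + 1 < n \<longrightarrow>
            R k = circulant_of_col (vec n (\<lambda>j.
              1 / of_nat n * (ones_vec n \<bullet>
                ((residual n A k \<circ>\<^sub>H (cyc_perm_mat n ^\<^sub>m j)) *\<^sub>v ones_vec n)))) \<and>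
            (\<forall>j<n. R k $$ (j, 0) =
              (\<Sum>pq\<in>cycle_pos n j. residual n A k $$ pq) / of_nat (card (cycle_pos n j)))) \<and>
         R (n - 1) = residual n A (n - 1)"
proof -
  have car: "R k \<in> carrier_mat n n" if "k < n" for k
    using assms(3)[OF that] by (simp add: circulant_def)
  have res: "residual n A k = shifted_tail n R k" if "k < n" for k
    using that assms(3) car
    unfolding assms(4) by (simp add: finsum_phase_diag_eq_shifted_tail residual_eq_shifted_tail)
  have mean: "cycle_mean_col n (residual n A k) = col (R k) 0" if "k < n" for k
    using that assms(3) by (simp add: res cycle_mean_col_shifted_tail)
  have "R k = circulant_of_col (cycle_mean_col n (residual n A k))" if "k < n" for k
    using that circulant_iff_circulant_of_col[OF assms(1) car] assms(3) by (simp add: mean)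
  moreover have "R k $$ (j, 0) =
      (\<Sum>pq\<in>cycle_pos n j. residual n A k $$ pq) / of_nat (card (cycle_pos n j))"
    if "k < n" "j < n" for k j
    using arg_cong[OF mean[OF that(1)], of "\<lambda>v. v $ j"] that car[OF that(1)]
    by (simp add: res cycle_mean_col_eq_average)
  moreover have "R (n - 1) = residual n A (n - 1)"
  proof -
    have "{n - 1..<n} = {n - 1}" using assms(1) by auto
    thus ?thesis
      using assms(1) car[of "n - 1"] by (intro eq_matI) (auto simp: res shifted_tail_def)
  qed
  ultimately show ?thesis
    unfolding cycle_mean_col_def by simp
qed

end
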